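(* Let $1\le p\le\infty$ and let $f\in L_p[0,1]$ be a self-similar function of zero spectral order with parameters $n,a_k,d_k,\beta_k$. Let $\hat k$ be the unique index with $d_{\hat k}\neq0$, suppose that $\hat G_{\hat k}=G_{\hat k}$ (orientation preserving), and let $\hat x=\alpha_{\hat k}/(1-a_{\hat k})$. Assume that $\beta_i\neq\beta_{i+1}$ whenever $1\le i\le n-1$ and $i,i+1\neq\hat k$, and that $f$ is not almost everywhere equal to a constant. Then the following holds. 1. If $|d_{\hat k}|<1$, then $f$ is bounded and $\lim_{x\to\hat x}f(x)=\dfrac{\beta_{\hat k}}{1-d_{\hat k}}$. 2. Let $d_{\hat k}=1$. (a) If $\beta_{\hat k}=0$, $n=3$ and $\hat k=2$, then $f$ takes finitely many values, $\hat x$ is a discontinuity of the first kind, $f(\hat x-0)=\beta_1$ and $f(\hat x+0)=\beta_3$. (b) If $\beta_{\hat k}=0$ and it is not the case that both $n=3$ and $\hat k=2$, then $\hat x$ is a discontinuity of the second kind. (c) If $\beta_{\hat k}\neq0$, then $\lim_{x\to\hat x}f(x)=\operatorname{sign}(\beta_{\hat k})\cdot(+\infty)$. 3. Let $d_{\hat k}>1$. (a) If all the numbers $\frac{\beta_{\hat k}}{d_{\hat k}-1}+\beta_j$, $j\neq\hat k$, have the same sign, then $\lim_{x\to\hat x}f(x)=\operatorname{sign}\left(\frac{\beta_{\hat k}}{d_{\hat k}-1}+\beta_j\right)\cdot(+\infty)$. (b) If the numbers $\frac{\beta_{\hat k}}{d_{\hat k}-1}+\beta_j$, $j\neq\hat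 k$, do not all have the same sign (zero being considered to have a sign different from both positive and negative numbers), then $\hat x$ is a discontinuity of the second kind. Moreover, if $\hat k=2$ and $d_2\beta_1+\beta_2=\beta_1$, then $f(\hat x-0)$ exists and equals $\beta_1$; if $\hat k=n-1$ and $d_{n-1}\beta_n+\beta_{n-1}=\beta_n$, then $f(\hat x+0)$ exists and equals $\beta_n$. 4. If $d_{\hat k}\le-1$, then $\hat x$ is a discontinuity of the second kind.
   Context: Similarity operators. Fix an integer $n>1$, real numbers $a_k>0$ ($k=1,\dots,n$) with $\sum_{k=1}^n a_k=1$, and real numbers $d_k,\beta_k$ ($k=1,\dots,n$). Put $\alpha_1=0$ and $\alpha_k=\sum_{l=1}^{k-1}a_l$ for $k=2,\dots,n+1$, so that $0=\alpha_1<\dots<\alpha_{n+1}=1$. For $f\in L_p[0,1]$ and $x\in[\alpha_k,\alpha_{k+1}]$ put $G_k(f)(x)=f\big((x-\alpha_k)/a_k\big)$ (orientation preserving) and $\tilde G_k(f)(x)=f\big((\alpha_{k+1}-x)/a_k\big)$ (orientation reversing); both are regarded as zero outside $[\alpha_k,\alpha_{k+1}]$. For each $k$ let $\hat G_k$ be either $G_k$ or $\tilde G_k$. The similarity operator $G:L_p[0,1]\to L_p[0,1]$ is $$G(f)=\sum_{k=1}^n\left\{\beta_k\,\chi_{(\alpha_k,\alpha_{k+1})}+d_k\,\hat G_k(f)\right\},$$ where $\chi$ denotes a characteristic function. Standing assumptions. $G$ is a contraction in $L_p[0,1]$: $\sum_{k=1}^n a_k|d_k|^p<1$ if $1\le p<\infty$,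 respectively $\max_k|d_k|<1$ if $p=\infty$. At least one of the $\beta_k$ is nonzero. A function $f\in L_p[0,1]$ is self-similar if $G(f)=f$ for such a $G$ (the fixed point is unique). It is called a self-similar function of zero spectral order if exactly one of the numbers $d_1,\dots,d_n$ is nonzero. Limits of $f$ (an element of $L_p[0,1]$), as well as boundedness and "taking finitely many values", are understood up to null sets: e.g. $f(x_0+0)=L$ (with $L$ finite or $\pm\infty$) means that for every neighbourhood $U$ of $L$ there is $\delta>0$ with $f(x)\in U$ for almost every $x\in(x_0,x_0+\delta)$; similarly for $f(x_0-0)$ and for two-sided limits. At an endpoint of $[0,1]$ only the one-sided limit from inside $[0,1]$ is considered. The point $\hat x$ is a discontinuity of the first kind if $f(\hat x-0)$ and $f(\hat x+0)$ exist, are finite and are different; it is a discontinuity of the second kind if at least one of the one-sided limits of $f$ at $\hat x$ that make sense does not exist or is infinite. *)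

theory Defs
  imports "HOL-Analysis.Analysis"
begin

text \<open>Elements of the spaces \<open>L\<^sub>p[0,1]\<close> are represented by real functions on the whole line, of
  which only the behaviour on \<open>[0,1]\<close> up to null sets is ever used. Parameter families such as
  \<open>a\<^sub>1, \<dots>, a\<^sub>n\<close> are functions on \<^typ>\<open>nat\<close> of which only the values on \<open>{1..n}\<close> matter.\<close>

abbreviation leb01 :: "real measure" where
  "leb01 \<equiv> lebesgue_on {0..1}"

definition Lp01 :: "ennreal \<Rightarrow> (real \<Rightarrow> real) set" where
  "Lp01 p = {f \<in> borel_measurable leb01.
     if p = \<infinity> then \<exists>C. AE x in leb01. \<bar>f x\<bar> \<le> C
     else integrable leb01 (\<lambda>x. \<bar>f x\<bar> powr enn2real p)}"


subsection \<open>Similarity operators\<close>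

definition alpha :: "(nat \<Rightarrow> real) \<Rightarrow> nat \<Rightarrow> real" where
  "alpha a k = (\<Sum>l = 1..<k. a l)"

datatype orientation = Preserving | Reversing

fun G_hat :: "(nat \<Rightarrow> real) \<Rightarrow> orientation \<Rightarrow> nat \<Rightarrow> (real \<Rightarrow> real) \<Rightarrow> real \<Rightarrow> real" where
  "G_hat a Preserving k f x =
     (if x \<in> {alpha a k..alpha a (k + 1)} then f ((x - alpha a k) / a k) else 0)"
| "G_hat a Reversing k f x =
     (if x \<in> {alpha a k..alpha a (k + 1)} then f ((alpha a (k + 1) - x) / a k) else 0)"

definition similarity_op ::
  "nat \<Rightarrow> (nat \<Rightarrow> real) \<Rightarrow> (nat \<Rightarrow> real) \<Rightarrow> (nat \<Rightarrow> real) \<Rightarrow> (nat \<Rightarrow> orientation)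
    \<Rightarrow> (real \<Rightarrow> real) \<Rightarrow> real \<Rightarrow> real" where
  "similarity_op n a d \<beta> ori f x =
     (\<Sum>k = 1..n. \<beta> k * indicator {alpha a k<..<alpha a (k + 1)} x + d k * G_hat a (ori k) k f x)"

definition contraction_cond :: "ennreal \<Rightarrow> nat \<Rightarrow> (nat \<Rightarrow> real) \<Rightarrow> (nat \<Rightarrow> real) \<Rightarrow> bool" where
  "contraction_cond p n a d \<longleftrightarrow>
     (if p = \<infinity> then (MAX k\<in>{1..n}. \<bar>d k\<bar>) < 1
      else (\<Sum>k = 1..n. a k * \<bar>d k\<bar> powr enn2real p) < 1)"

definition similarity_params ::
  "ennreal \<Rightarrow> nat \<Rightarrow> (nat \<Rightarrow> real) \<Rightarrow> (nat \<Rightarrow> real) \<Rightarrow> (nat \<Rightarrow> real) \<Rightarrow> bool" where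
  "similarity_params p n a d \<beta> \<longleftrightarrow>
     1 < n \<and> (\<forall>k\<in>{1..n}. 0 < a k) \<and> (\<Sum>k = 1..n. a k) = 1
     \<and> contraction_cond p n a d \<and> (\<exists>k\<in>{1..n}. \<beta> k \<noteq> 0)"

definition self_similar ::
  "ennreal \<Rightarrow> nat \<Rightarrow> (nat \<Rightarrow> real) \<Rightarrow> (nat \<Rightarrow> real) \<Rightarrow> (nat \<Rightarrow> real) \<Rightarrow> (nat \<Rightarrow> orientation)
    \<Rightarrow> (real \<Rightarrow> real) \<Rightarrow> bool" where
  "self_similar p n a d \<beta> ori f \<longleftrightarrow>
     similarity_params p n a d \<beta> \<and> f \<in> Lp01 p
     \<and> (AE x in leb01. similarity_op n a d \<beta> ori f x = f x)"

definition zero_spectral_order :: "nat \<Rightarrow> (nat \<Rightarrow> real) \<Rightarrow> bool" where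
  "zero_spectral_order n d \<longleftrightarrow> (\<exists>!k. k \<in> {1..n} \<and> d k \<noteq> 0)"


subsection \<open>Limits and discontinuities up to null sets\<close>

text \<open>Each kind of limit only exists at those points of \<open>[0,1]\<close> where it makes sense. At an endpoint
  the two-sided limit is the one-sided limit from inside, because \<^const>\<open>leb01\<close> ignores points
  outside \<open>[0,1]\<close>.\<close>

definition ess_left_lim :: "(real \<Rightarrow> real) \<Rightarrow> real \<Rightarrow> ereal \<Rightarrow> bool" where
  "ess_left_lim f x0 L \<longleftrightarrow> x0 \<in> {0<..1} \<and>
     (\<forall>U. open U \<and> L \<in> U \<longrightarrow>
        (\<exists>\<delta>>0. AE x in leb01. x \<in> {x0 - \<delta><..<x0} \<longrightarrow> ereal (f x) \<in> U))"

definition ess_right_lim :: "(real \<Rightarrow> real) \<Rightarrow> real \<Rightarrow> ereal \<Rightarrow> bool" where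
  "ess_right_lim f x0 L \<longleftrightarrow> x0 \<in> {0..<1} \<and>
     (\<forall>U. open U \<and> L \<in> U \<longrightarrow>
        (\<exists>\<delta>>0. AE x in leb01. x \<in> {x0<..<x0 + \<delta>} \<longrightarrow> ereal (f x) \<in> U))"

definition ess_lim :: "(real \<Rightarrow> real) \<Rightarrow> real \<Rightarrow> ereal \<Rightarrow> bool" where
  "ess_lim f x0 L \<longleftrightarrow> x0 \<in> {0..1} \<and>
     (\<forall>U. open U \<and> L \<in> U \<longrightarrow>
        (\<exists>\<delta>>0. AE x in leb01. x \<noteq> x0 \<and> \<bar>x - x0\<bar> < \<delta> \<longrightarrow> ereal (f x) \<in> U))"

definition discontinuity_first_kind :: "(real \<Rightarrow> real) \<Rightarrow> real \<Rightarrow> bool" where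
  "discontinuity_first_kind f x0 \<longleftrightarrow>
     (\<exists>l r :: real. ess_left_lim f x0 (ereal l) \<and> ess_right_lim f x0 (ereal r) \<and> l \<noteq> r)"

definition discontinuity_second_kind :: "(real \<Rightarrow> real) \<Rightarrow> real \<Rightarrow> bool" where
  "discontinuity_second_kind f x0 \<longleftrightarrow>
     (x0 \<in> {0<..1} \<and>
        (\<not> (\<exists>L. ess_left_lim f x0 L) \<or> ess_left_lim f x0 \<infinity> \<or> ess_left_lim f x0 (-\<infinity>)))
   \<or> (x0 \<in> {0..<1} \<and>
        (\<not> (\<exists>L. ess_right_lim f x0 L) \<or> ess_right_lim f x0 \<infinity> \<or> ess_right_lim f x0 (-\<infinity>)))"

definition ess_bounded :: "(real \<Rightarrow> real) \<Rightarrow> bool" where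
  "ess_bounded f \<longleftrightarrow> (\<exists>C. AE x in leb01. \<bar>f x\<bar> \<le> C)"

definition ess_finitely_many_values :: "(real \<Rightarrow> real) \<Rightarrow> bool" where
  "ess_finitely_many_values f \<longleftrightarrow> (\<exists>V. finite V \<and> (AE x in leb01. f x \<in> V))"

definition ess_constant :: "(real \<Rightarrow> real) \<Rightarrow> bool" where
  "ess_constant f \<longleftrightarrow> (\<exists>c. AE x in leb01. f x = c)"

end

theory Submission
  imports Defs
begin

text \<open>
  Write \<open>k\<close> for the index with \<open>d\<^sub>k \<noteq> 0\<close>. The affine map \<open>S\<close> taking \<open>[0,1]\<close> onto the \<open>k\<close>-th interval
  contracts by the factor \<open>a\<^sub>k\<close> towards its fixed point, which is \<open>xh\<close>. On every other interval
  \<open>I\<^sub>j = (\<alpha>\<^sub>j, \<alpha>\<^sub>j\<^sub>+\<^sub>1)\<close> the fixed-point equation says \<open>f = \<beta>\<^sub>j\<close>, and on the \<open>k\<close>-th one it says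
  \<open>f \<circ> S = g \<circ> f\<close> with \<open>g t = \<beta>\<^sub>k + d\<^sub>k * t\<close>. Hence \<open>f\<close> is almost everywhere the constant
  \<open>g\<^sup>m \<beta>\<^sub>j\<close> on the open interval \<open>S\<^sup>m I\<^sub>j\<close> (lemma \<open>f_on_piece\<close>), and these intervals, for \<open>m \<ge> 0\<close> and
  \<open>j \<noteq> k\<close>, exhaust \<open>[0,1]\<close> up to a countable set (lemma \<open>pieces_cover\<close>).

  Those with \<open>j < k\<close> lie to the left of \<open>xh\<close>, those with \<open>j > k\<close> to the right, and the distance of
  \<open>S\<^sup>m I\<^sub>j\<close> from \<open>xh\<close> is comparable to \<open>a\<^sub>k\<^sup>m\<close>. So \<open>L\<close> is a (one-sided) essential limit of \<open>f\<close> at \<open>xh\<close>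
  exactly when all the sequences \<open>g\<^sup>m \<beta>\<^sub>j\<close> with \<open>j\<close> on the relevant sides tend to \<open>L\<close>
  (lemma \<open>ess_limit_iff_orbits\<close>). What remains concerns orbits of one affine map: for \<open>d\<^sub>k = 1\<close>
  they are \<open>\<beta>\<^sub>j + m * \<beta>\<^sub>k\<close>, otherwise they are \<open>t + d\<^sub>k\<^sup>m * (\<beta>\<^sub>j - t)\<close> with the fixed point
  \<open>t = \<beta>\<^sub>k / (1 - d\<^sub>k)\<close>. A function that is not constant has an orbit off the fixed point, and
  such an orbit never converges to a real number when \<open>\<bar>d\<^sub>k\<bar> \<ge> 1\<close> and \<open>d\<^sub>k \<noteq> 1\<close>; this one fact
  gives every discontinuity of the second kind except the case of the identity map \<open>g\<close>, where
  two adjacent intervals on the same side carry different constants at every scale.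
\<close>


section \<open>Null sets and sequences\<close>

lemma AE_leb01_iff:
  "(AE x in leb01. P x) \<longleftrightarrow> (AE x in lborel. x \<in> {0..1} \<longrightarrow> P x)"
  by (subst AE_restrict_space_iff) (auto simp: AE_completion_iff)

text \<open>
  Nothing is assumed about the measurability of \<open>P\<close>: the affine map is applied to a measurable null
  set containing the exceptional points instead.
\<close>
lemma AE_lborel_affine:
  fixes c t :: real
  assumes "c \<noteq> 0" and "AE x in lborel. P x"
  shows "AE x in lborel. P (t + c * x)"
proof -
  obtain N where N: "N \<in> null_sets lborel" "{x. \<not> P x} \<subseteq> N"
    using assms(2) by (auto simp: eventually_ae_filter)
  have "AE x in lborel. x \<notin> N"
    using N(1) by (rule AE_not_in)
  moreover have "Measurable.pred borel (\<lambda>x. x \<notin> N)"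
    using N(1) by (auto simp: pred_def null_sets_def)
  ultimately have "AE x in lborel. t + c * x \<notin> N"
    using AE_borel_affine[OF assms(1)] by blast
  then show ?thesis
    by eventually_elim (use N(2) in auto)
qed

text \<open>
  This turns almost-everywhere information about a function that is constant on an interval
  into a fact about the constant.
\<close>
lemma AE_interval_nonempty:
  fixes u v :: real
  assumes "AE x in lborel. x \<in> {u<..<v} \<longrightarrow> P x" and "u < v"
  obtains x where "x \<in> {u<..<v}" "P x"
proof -
  have "\<exists>x \<in> {u<..<v}. P x"
  proof (rule ccontr)
    assume "\<not> (\<exists>x \<in> {u<..<v}. P x)"
    with assms(1) have "AE x in lborel. x \<notin> {u<..<v}"
      by (auto elim: eventually_mono)
    then have "{u<..<v} \<in> null_sets lborel"
      by (subst AE_iff_null_sets) auto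
    with \<open>u < v\<close> show False by (simp add: null_sets_def)
  qed
  with that show thesis by blast
qed

lemma affine_tendsto_sgn_infinity:
  fixes b c :: real and s :: "nat \<Rightarrow> real"
  assumes "filterlim s at_top sequentially" "c \<noteq> 0"
  shows "(\<lambda>m. ereal (b + s m * c)) \<longlonglongrightarrow> ereal (sgn c) * \<infinity>"
proof (cases "c > 0")
  case True
  then have "filterlim (\<lambda>m. b + s m * c) at_top sequentially"
    using assms(1)
    by (intro filterlim_tendsto_add_at_top[OF tendsto_const] filterlim_at_top_mult_tendsto_pos[OF tendsto_const])
  then show ?thesis using True by (simp add: tendsto_PInfty_eq_at_top)
next
  case False
  with assms(2) have c: "c < 0" by simp
  then have "filterlim (\<lambda>m. - b + s m * (- c)) at_top sequentially"
    using assms(1)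
    by (intro filterlim_tendsto_add_at_top[OF tendsto_const] filterlim_at_top_mult_tendsto_pos[OF tendsto_const]) auto
  then have "filterlim (\<lambda>m. - (b + s m * c)) at_top sequentially" by simp
  then have "filterlim (\<lambda>m. b + s m * c) at_bot sequentially"
    by (subst filterlim_uminus_at_bot)
  then show ?thesis
    using c by (simp add: tendsto_MInfty filterlim_at_bot_dense)
qed


section \<open>The tiling by rescaled pieces\<close>

lemma alpha_Suc: "1 \<le> k \<Longrightarrow> alpha a (Suc k) = alpha a k + a k"
  by (simp add: alpha_def)

lemma alpha_1: "alpha a (Suc 0) = 0"
  by (simp add: alpha_def)

lemma alpha_mono:
  assumes "\<And>j. j \<in> {1..n} \<Longrightarrow> 0 < a j" and "1 \<le> i" "i \<le> j" "j \<le> Suc n"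
  shows "alpha a i \<le> alpha a j"
  using assms(3,4)
proof (induction j rule: dec_induct)
  case (step j)
  then show ?case using alpha_Suc[of j a] assms(1)[of j] assms(2) by auto
qed simp

lemma between_consecutive_alphas:
  assumes "\<And>j. y \<noteq> alpha a j" and "0 \<le> y" and "y \<le> alpha a (Suc N)"
  shows "\<exists>j\<in>{1..N}. y \<in> {alpha a j<..<alpha a (Suc j)}"
  using assms(3)
proof (induction N)
  case 0
  then show ?case using assms(1)[of "Suc 0"] assms(2) by (simp add: alpha_1)
next
  case (Suc N)
  show ?case
  proof (cases "y \<le> alpha a (Suc N)")
    case True
    then show ?thesis using Suc.IH by fastforce
  next
    case False
    then have "y \<in> {alpha a (Suc N)<..<alpha a (Suc (Suc N))}"
      using Suc.prems assms(1)[of "Suc (Suc N)"] by auto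
    then show ?thesis by (intro bexI[of _ "Suc N"]) auto
  qed
qed

text \<open>
  The fixed-point equation in the case where only the \<open>k\<close>-th branch feeds \<open>f\<close> back into itself;
  \<open>xh\<close> is the point fixed by \<open>x \<mapsto> alpha a k + a k * x\<close>.
\<close>
locale one_branch_fixed_point =
  fixes n k :: nat and a \<beta> :: "nat \<Rightarrow> real" and d xh :: real and f :: "real \<Rightarrow> real"
  assumes n_gt_1: "1 < n"
    and a_pos: "\<And>j. j \<in> {1..n} \<Longrightarrow> 0 < a j"
    and a_sum: "(\<Sum>j = 1..n. a j) = 1"
    and k_in: "k \<in> {1..n}"
    and xh_def: "xh = alpha a k / (1 - a k)"
    and f_const: "\<And>j. j \<in> {1..n} - {k} \<Longrightarrow>
      AE x in leb01. x \<in> {alpha a j<..<alpha a (Suc j)} \<longrightarrow> f x = \<beta> j"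
    and f_branch:
      "AE x in leb01. x \<in> {alpha a k<..<alpha a (Suc k)} \<longrightarrow> f x = \<beta> k + d * f ((x - alpha a k) / a k)"
begin

lemma alpha_le: "1 \<le> i \<Longrightarrow> i \<le> j \<Longrightarrow> j \<le> Suc n \<Longrightarrow> alpha a i \<le> alpha a j"
  using alpha_mono[of n a i j] a_pos by blast

lemma alpha_end: "alpha a (Suc n) = 1"
  using a_sum by (simp add: alpha_def atLeastLessThanSuc_atLeastAtMost)

lemma alpha_nonneg: "1 \<le> j \<Longrightarrow> j \<le> Suc n \<Longrightarrow> 0 \<le> alpha a j"
  using alpha_le[of 1 j] by (simp add: alpha_1)

lemma alpha_le_1: "1 \<le> j \<Longrightarrow> j \<le> Suc n \<Longrightarrow> alpha a j \<le> 1"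
  using alpha_le[of j "Suc n"] by (simp add: alpha_end)

lemma alpha_less: "1 \<le> j \<Longrightarrow> j \<le> n \<Longrightarrow> alpha a j < alpha a (Suc j)"
  using alpha_Suc[of j a] a_pos[of j] by simp

lemma ak_pos: "0 < a k"
  using a_pos k_in by blast

lemma ak_less_1: "a k < 1"
proof -
  obtain j where j: "j \<in> {1..n}" "j \<noteq> k"
    using n_gt_1 by (cases "k = 1") (auto intro: that[of 1] that[of 2])
  have "(\<Sum>i\<in>{k, j}. a i) \<le> (\<Sum>i = 1..n. a i)"
    using a_pos k_in j by (intro sum_mono2) (auto intro: less_imp_le)
  then show ?thesis using a_pos[OF j(1)] j a_sum by simp
qed

lemma alpha_k: "alpha a k = xh - a k * xh" and alpha_Suc_k: "alpha a (Suc k) = xh + a k * (1 - xh)"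
proof -
  show *: "alpha a k = xh - a k * xh"
  proof -
    have "alpha a k = xh * (1 - a k)" using ak_less_1 by (simp add: xh_def)
    then show ?thesis by (simp add: algebra_simps)
  qed
  show "alpha a (Suc k) = xh + a k * (1 - xh)"
    using alpha_Suc[of k a] k_in * by (simp add: algebra_simps)
qed

lemma xh_nonneg: "0 \<le> xh" and xh_le_1: "xh \<le> 1"
proof -
  show "0 \<le> xh"
    using alpha_nonneg[of k] k_in ak_less_1 by (simp add: xh_def)
  have "alpha a k + a k \<le> 1"
    using alpha_Suc[of k a] alpha_le_1[of "Suc k"] k_in by simp
  then show "xh \<le> 1"
    using ak_less_1 by (simp add: xh_def field_simps)
qed

lemma xh_pos: "1 < k \<Longrightarrow> 0 < xh"
proof -
  assume "1 < k"
  then have "0 < alpha a k"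
    using alpha_le[of "Suc 1" k] alpha_Suc[of 1 a] a_pos[of 1] k_in n_gt_1 by (simp add: alpha_1)
  then show ?thesis using ak_less_1 by (simp add: xh_def)
qed

lemma xh_less_1: "k < n \<Longrightarrow> xh < 1"
proof -
  assume "k < n"
  then have "alpha a k + a k < 1"
    using alpha_le[of "Suc k" n] alpha_Suc[of k a] alpha_less[of n] k_in n_gt_1
    by (simp add: alpha_end)
  then show ?thesis
    using ak_less_1 by (simp add: xh_def field_simps)
qed

text \<open>
  The image of the \<open>j\<close>-th open interval \<open>I\<^sub>j\<close> under the \<open>m\<close>-th iterate of the affine map \<open>S\<close> of the
  \<open>k\<close>-th branch. Since \<open>S x = xh + a k * (x - xh)\<close>, measuring from \<open>xh\<close> makes the iterates explicit.
\<close>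
definition piece :: "nat \<Rightarrow> nat \<Rightarrow> real set" where
  "piece m j = {xh + a k ^ m * (alpha a j - xh) <..< xh + a k ^ m * (alpha a (Suc j) - xh)}"

definition orbit :: "nat \<Rightarrow> nat \<Rightarrow> real" where
  "orbit j m = ((\<lambda>t. \<beta> k + d * t) ^^ m) (\<beta> j)"

lemma ak_power_bounds: "0 < a k ^ m" "a k ^ m \<le> 1"
  using ak_pos ak_less_1 by (auto intro: power_le_one)

lemma mem_piece:
  "x \<in> piece m j \<longleftrightarrow> alpha a j < xh + (x - xh) / a k ^ m \<and> xh + (x - xh) / a k ^ m < alpha a (Suc j)"
proof -
  have "alpha a j < xh + (x - xh) / a k ^ m \<longleftrightarrow> alpha a j - xh < (x - xh) / a k ^ m"
    "xh + (x - xh) / a k ^ m < alpha a (Suc j) \<longleftrightarrow> (x - xh) / a k ^ m < alpha a (Suc j) - xh"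
    by auto
  then show ?thesis
    using ak_power_bounds(1)[of m] by (auto simp: piece_def pos_less_divide_eq pos_divide_less_eq mult.commute)
qed

lemma piece_bounds:
  assumes "j \<in> {1..n}" "x \<in> piece m j"
  shows "- (a k ^ m * xh) < x - xh" "x - xh < a k ^ m * (1 - xh)"
proof -
  have "a k ^ m * (0 - xh) \<le> a k ^ m * (alpha a j - xh)"
    "a k ^ m * (alpha a (Suc j) - xh) \<le> a k ^ m * (1 - xh)"
    using alpha_nonneg[of j] alpha_le_1[of "Suc j"] assms(1) ak_power_bounds(1)[of m]
    by (intro mult_left_mono; auto)+
  then show "- (a k ^ m * xh) < x - xh" "x - xh < a k ^ m * (1 - xh)"
    using assms(2) by (auto simp: piece_def)
qed

lemma piece_abs_less:
  assumes "j \<in> {1..n}" "x \<in> piece m j"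
  shows "\<bar>x - xh\<bar> < a k ^ m"
proof -
  have "a k ^ m * xh \<le> a k ^ m * 1" "a k ^ m * (1 - xh) \<le> a k ^ m * 1"
    using ak_power_bounds(1)[of m] xh_nonneg xh_le_1 by (intro mult_left_mono; auto)+
  then show ?thesis using piece_bounds[OF assms] by auto
qed

lemma piece_unit:
  assumes "j \<in> {1..n}" "x \<in> piece m j"
  shows "x \<in> {0<..<1}"
proof -
  have "a k ^ m * xh \<le> 1 * xh" "a k ^ m * (1 - xh) \<le> 1 * (1 - xh)"
    using ak_power_bounds[of m] xh_nonneg xh_le_1 by (intro mult_right_mono; auto)+
  then show ?thesis using piece_bounds[OF assms] by auto
qed

text \<open>
  The endpoint of \<open>I\<^sub>k\<close> nearest to \<open>I\<^sub>j\<close> separates \<open>I\<^sub>j\<close> from \<open>xh\<close>. Its distance from \<open>xh\<close> is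
  \<open>a k * xh\<close> on the left and \<open>a k * (1 - xh)\<close> on the right, as \<open>I\<^sub>k\<close> is the image of \<open>[0,1]\<close>.
\<close>
lemma piece_left:
  assumes "1 \<le> j" "j < k" "x \<in> piece m j"
  shows "x - xh < - (a k ^ m * (a k * xh))"
proof -
  have "a k ^ m * (alpha a (Suc j) - xh) \<le> a k ^ m * (alpha a k - xh)"
    using alpha_le[of "Suc j" k] assms k_in ak_power_bounds(1)[of m] by (intro mult_left_mono) auto
  then show ?thesis using assms(3) by (auto simp: piece_def alpha_k algebra_simps)
qed

lemma piece_right:
  assumes "k < j" "j \<le> n" "x \<in> piece m j"
  shows "a k ^ m * (a k * (1 - xh)) < x - xh"
proof -
  have "a k ^ m * (alpha a (Suc k) - xh) \<le> a k ^ m * (alpha a j - xh)"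
    using alpha_le[of "Suc k" j] assms k_in ak_power_bounds(1)[of m] by (intro mult_left_mono) auto
  then show ?thesis using assms(3) by (auto simp: piece_def alpha_Suc_k algebra_simps)
qed

text \<open>
  One application of the fixed-point equation moves from \<open>piece (Suc m) j\<close>, which lies in the
  \<open>k\<close>-th interval, to \<open>piece m j\<close>; the null set is carried along by the affine change of variable.
\<close>
lemma f_on_piece:
  assumes "j \<in> {1..n} - {k}"
  shows "AE x in lborel. x \<in> piece m j \<longrightarrow> f x = orbit j m"
proof (induction m)
  case 0
  have "x \<in> {0..1}" if "x \<in> piece 0 j" for x
    using piece_unit[OF _ that] assms by auto
  moreover have "piece 0 j = {alpha a j<..<alpha a (Suc j)}"
    by (simp add: piece_def)
  ultimately show ?case
    using f_const[OF assms, unfolded AE_leb01_iff] by (auto simp: orbit_def elim: eventually_mono)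
next
  case (Suc m)
  let ?T = "\<lambda>x. - alpha a k / a k + 1 / a k * x"
  have T: "?T x = (x - alpha a k) / a k" for x
    by (simp add: diff_divide_distrib)
  have "AE x in lborel. ?T x \<in> piece m j \<longrightarrow> f (?T x) = orbit j m"
    using AE_lborel_affine[OF _ Suc.IH, of "1 / a k" "- alpha a k / a k"] ak_pos by simp
  moreover note f_branch[unfolded AE_leb01_iff]
  ultimately show ?case
  proof eventually_elim
    case (elim x)
    show ?case
    proof
      assume x: "x \<in> piece (Suc m) j"
      have "xh + ((x - alpha a k) / a k - xh) / a k ^ m = xh + (x - xh) / a k ^ Suc m"
        using ak_pos by (simp add: alpha_k field_simps)
      then have y: "(x - alpha a k) / a k \<in> piece m j"
        using x by (simp only: mem_piece)
      then have "(x - alpha a k) / a k \<in> {0<..<1}"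
        using piece_unit assms by blast
      then have "x \<in> {alpha a k<..<alpha a (Suc k)}"
        using ak_pos alpha_Suc[of k a] k_in by (auto simp: field_simps)
      moreover have "x \<in> {0..1}"
        using piece_unit[OF _ x] assms by auto
      ultimately show "f x = orbit j (Suc m)"
        using elim(1)[unfolded T] elim(2) y by (simp add: orbit_def)
    qed
  qed
qed

text \<open>
  Blowing up \<open>x \<noteq> xh\<close> about \<open>xh\<close> by \<open>1 / a k\<close> drives it out of \<open>[0,1]\<close>. Its last position inside
  cannot lie in the \<open>k\<close>-th interval, which is exactly the set that a blow-up maps onto \<open>[0,1]\<close>, so
  it lies in one of the other \<open>I\<^sub>j\<close>. The excluded points are \<open>xh\<close> and the endpoints of all pieces.
\<close>
lemma pieces_cover:
  "AE x in lborel. x \<in> {0..1} \<longrightarrow> (\<exists>m. \<exists>j\<in>{1..n} - {k}. x \<in> piece m j)"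
proof -
  let ?E = "insert xh (range (\<lambda>(m, j). xh + a k ^ m * (alpha a j - xh)))"
  have "AE x in lborel. x \<notin> ?E"
    by (intro AE_not_in countable_imp_null_set_lborel) auto
  then show ?thesis
  proof eventually_elim
    case (elim x)
    show ?case
    proof
      assume x: "x \<in> {0..1}"
      define y where "y m = xh + (x - xh) / a k ^ m" for m
      have "x \<noteq> xh" using elim by auto
      have y_ne: "y m \<noteq> alpha a j" for m j
      proof
        assume "y m = alpha a j"
        then have "x = (\<lambda>(m, j). xh + a k ^ m * (alpha a j - xh)) (m, j)"
        proof -
          have "(x - xh) / a k ^ m = alpha a j - xh"
            using \<open>y m = alpha a j\<close> by (simp add: y_def)
          then have "x - xh = a k ^ m * (alpha a j - xh)"
            using ak_power_bounds(1)[of m] by (metis less_irrefl mult.commute nonzero_divide_eq_eq)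
          then show ?thesis by simp
        qed
        then show False using elim by blast
      qed
      obtain M where M: "a k ^ M < \<bar>x - xh\<bar>"
        using real_arch_pow_inv[of "\<bar>x - xh\<bar>" "a k"] ak_less_1 \<open>x \<noteq> xh\<close> by auto
      have "y M \<notin> {0..1}"
      proof
        assume "y M \<in> {0..1}"
        then have "\<bar>y M - xh\<bar> \<le> 1" using xh_nonneg xh_le_1 by auto
        then show False using M ak_power_bounds(1)[of M] by (auto simp: y_def abs_divide field_simps)
      qed
      moreover have "y 0 \<in> {0..1}" using x by (simp add: y_def)
      ultimately obtain m where m: "y m \<in> {0..1}" "y (Suc m) \<notin> {0..1}"
        using nat_induct[of "\<lambda>m. y m \<in> {0..1}" M] by blast
      obtain j where j: "j \<in> {1..n}" "y m \<in> {alpha a j<..<alpha a (Suc j)}"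
        using between_consecutive_alphas[of "y m" a n] y_ne m(1) by (auto simp: alpha_end)
      have "y (Suc m) = (y m - alpha a k) / a k"
        using ak_pos by (simp add: y_def alpha_k field_simps)
      moreover have "(y m - alpha a k) / a k \<in> {0..1}" if "j = k"
        using j ak_pos alpha_Suc[of k a] that by (auto simp: field_simps)
      ultimately have "j \<noteq> k" using m(2) by auto
      with j show "\<exists>m. \<exists>j\<in>{1..n} - {k}. x \<in> piece m j"
        unfolding mem_piece y_def by (intro exI[of _ m] bexI[of _ j]) auto
    qed
  qed
qed

lemma f_values:
  "AE x in lborel. x \<in> {0..1} \<longrightarrow> (\<exists>m. \<exists>j\<in>{1..n} - {k}. x \<in> piece m j \<and> f x = orbit j m)"
proof -
  have "AE x in lborel. \<forall>m. \<forall>j\<in>{1..n} - {k}. x \<in> piece m j \<longrightarrow> f x = orbit j m"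
    using f_on_piece by (subst AE_all_countable, intro allI, subst AE_ball_countable) auto
  with pieces_cover show ?thesis
    by eventually_elim blast
qed


section \<open>Essential limits as limits of orbits\<close>

text \<open>
  The set \<open>Q \<delta>\<close> is a left, right or punctured neighbourhood of \<open>xh\<close> of radius \<open>\<delta>\<close>, and \<open>J\<close> collects
  the indices of the pieces that approach \<open>xh\<close> inside it. Necessity: each such piece of high order
  lies in \<open>Q \<delta>\<close> and is not a null set. Sufficiency: a small \<open>Q \<delta>\<close> meets only pieces of high
  order, and these cover almost all of it.
\<close>
lemma ess_limit_iff_orbits:
  fixes Q :: "real \<Rightarrow> real set" and L :: ereal
  assumes J: "J \<subseteq> {1..n} - {k}"
    and deep: "\<And>M. \<exists>\<delta>>0. \<forall>x m j. j \<in> {1..n} - {k} \<longrightarrow> x \<in> Q \<delta> \<longrightarrow> x \<in> piece m j \<longrightarrow> j \<in> J \<and> M \<le> m"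
    and near: "\<And>\<delta> j m. \<delta> > 0 \<Longrightarrow> j \<in> J \<Longrightarrow> a k ^ m < \<delta> \<Longrightarrow> piece m j \<subseteq> Q \<delta>"
  shows "(\<forall>U. open U \<and> L \<in> U \<longrightarrow> (\<exists>\<delta>>0. AE x in leb01. x \<in> Q \<delta> \<longrightarrow> ereal (f x) \<in> U))
    \<longleftrightarrow> (\<forall>j\<in>J. (\<lambda>m. ereal (orbit j m)) \<longlonglongrightarrow> L)"
proof (intro iffI allI impI ballI)
  fix j assume *: "\<forall>U. open U \<and> L \<in> U \<longrightarrow> (\<exists>\<delta>>0. AE x in leb01. x \<in> Q \<delta> \<longrightarrow> ereal (f x) \<in> U)"
    and "j \<in> J"
  from \<open>j \<in> J\<close> J have j: "j \<in> {1..n} - {k}" by blast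
  show "(\<lambda>m. ereal (orbit j m)) \<longlonglongrightarrow> L"
  proof (rule topological_tendstoI)
    fix U assume "open U" "L \<in> U"
    then obtain \<delta> where \<delta>: "\<delta> > 0" "AE x in lborel. x \<in> {0..1} \<longrightarrow> x \<in> Q \<delta> \<longrightarrow> ereal (f x) \<in> U"
      using * unfolding AE_leb01_iff by blast
    have "(\<lambda>m. a k ^ m) \<longlonglongrightarrow> 0"
      using ak_pos ak_less_1 by (intro LIMSEQ_power_zero) auto
    then have "\<forall>\<^sub>F m in sequentially. a k ^ m < \<delta>"
      using \<delta>(1) by (rule order_tendstoD)
    then show "\<forall>\<^sub>F m in sequentially. ereal (orbit j m) \<in> U"
    proof eventually_elim
      case (elim m)
      have "AE x in lborel. x \<in> piece m j \<longrightarrow> ereal (orbit j m) \<in> U"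
        using \<delta>(2) f_on_piece[OF j, of m]
      proof eventually_elim
        case (elim x)
        then show ?case
          using near[OF \<delta>(1) \<open>j \<in> J\<close> \<open>a k ^ m < \<delta>\<close>] piece_unit[of j x m] j by fastforce
      qed
      moreover have "xh + a k ^ m * (alpha a j - xh) < xh + a k ^ m * (alpha a (Suc j) - xh)"
        using alpha_less[of j] j ak_power_bounds(1)[of m] by simp
      ultimately show ?case
        unfolding piece_def by (rule AE_interval_nonempty)
    qed
  qed
next
  fix U assume lim: "\<forall>j\<in>J. (\<lambda>m. ereal (orbit j m)) \<longlonglongrightarrow> L" and U: "open U \<and> L \<in> U"
  have "finite J" using J by (rule finite_subset) auto
  then have "\<forall>\<^sub>F m in sequentially. \<forall>j\<in>J. ereal (orbit j m) \<in> U"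
    using lim U by (auto intro!: eventually_ball_finite topological_tendstoD)
  then obtain M where M: "\<And>m j. M \<le> m \<Longrightarrow> j \<in> J \<Longrightarrow> ereal (orbit j m) \<in> U"
    by (auto simp: eventually_sequentially)
  obtain \<delta> where "\<delta> > 0"
    and \<delta>: "\<And>x m j. j \<in> {1..n} - {k} \<Longrightarrow> x \<in> Q \<delta> \<Longrightarrow> x \<in> piece m j \<Longrightarrow> j \<in> J \<and> M \<le> m"
    using deep[of M] by blast
  have "AE x in leb01. x \<in> Q \<delta> \<longrightarrow> ereal (f x) \<in> U"
    unfolding AE_leb01_iff using f_values
  proof eventually_elim
    case (elim x)
    then show ?case using \<delta> M by fastforce
  qed
  with \<open>\<delta> > 0\<close> show "\<exists>\<delta>>0. AE x in leb01. x \<in> Q \<delta> \<longrightarrow> ereal (f x) \<in> U"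
    by blast
qed

lemma piece_distance_bound:
  obtains r where "r > 0" "\<And>x m j. j \<in> {1..n} - {k} \<Longrightarrow> x \<in> piece m j \<Longrightarrow> a k ^ m * r < \<bar>x - xh\<bar>"
proof
  \<comment> \<open>If \<open>xh\<close> is an endpoint of \<open>[0,1]\<close>, there are no pieces on one side, and the zero distance on
    that side has to be kept out of the minimum.\<close>
  define r where "r = a k * min (if xh = 0 then 1 else xh) (if xh = 1 then 1 else 1 - xh)"
  show "r > 0"
    using ak_pos xh_nonneg xh_le_1 by (simp add: r_def)
  fix x m j assume j: "j \<in> {1..n} - {k}" and x: "x \<in> piece m j"
  show "a k ^ m * r < \<bar>x - xh\<bar>"
  proof (cases "j < k")
    case True
    then have "r \<le> a k * xh"
      using xh_pos j ak_pos by (auto simp: r_def)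
    then have "a k ^ m * r \<le> a k ^ m * (a k * xh)"
      using ak_power_bounds(1)[of m] by (intro mult_left_mono) auto
    then show ?thesis using piece_left[of j x m] True j x by auto
  next
    case False
    then have "r \<le> a k * (1 - xh)"
      using xh_less_1 j ak_pos by (auto simp: r_def)
    then have "a k ^ m * r \<le> a k ^ m * (a k * (1 - xh))"
      using ak_power_bounds(1)[of m] by (intro mult_left_mono) auto
    then show ?thesis using piece_right[of j x m] False j x by auto
  qed
qed

lemma piece_below: "1 \<le> j \<Longrightarrow> j < k \<Longrightarrow> x \<in> piece m j \<Longrightarrow> x < xh"
proof -
  have "0 \<le> a k ^ m * (a k * xh)" using ak_pos xh_nonneg by simp
  then show "1 \<le> j \<Longrightarrow> j < k \<Longrightarrow> x \<in> piece m j \<Longrightarrow> x < xh"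
    using piece_left[of j x m] by linarith
qed

lemma piece_above: "k < j \<Longrightarrow> j \<le> n \<Longrightarrow> x \<in> piece m j \<Longrightarrow> xh < x"
proof -
  have "0 \<le> a k ^ m * (a k * (1 - xh))" using ak_pos xh_le_1 by simp
  then show "k < j \<Longrightarrow> j \<le> n \<Longrightarrow> x \<in> piece m j \<Longrightarrow> xh < x"
    using piece_right[of j x m] by linarith
qed

lemma near_pieces_are_deep:
  "\<exists>\<delta>>0. \<forall>x m j. j \<in> {1..n} - {k} \<longrightarrow> \<bar>x - xh\<bar> < \<delta> \<longrightarrow> x \<in> piece m j \<longrightarrow> M \<le> m"
proof -
  obtain r where r: "r > 0" "\<And>x m j. j \<in> {1..n} - {k} \<Longrightarrow> x \<in> piece m j \<Longrightarrow> a k ^ m * r < \<bar>x - xh\<bar>"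
    using piece_distance_bound by blast
  show ?thesis
  proof (intro exI[of _ "a k ^ M * r"] conjI allI impI)
    show "a k ^ M * r > 0" using ak_power_bounds(1)[of M] r(1) by simp
    fix x m j assume "j \<in> {1..n} - {k}" "\<bar>x - xh\<bar> < a k ^ M * r" "x \<in> piece m j"
    then have "a k ^ m * r < a k ^ M * r" using r(2) by fastforce
    then have "a k ^ m < a k ^ M" using r(1) by simp
    then show "M \<le> m" using ak_pos ak_less_1 by (simp add: power_strict_decreasing_iff)
  qed
qed

lemma ess_left_lim_iff:
  "ess_left_lim f xh L \<longleftrightarrow> 1 < k \<and> (\<forall>j\<in>{1..<k}. (\<lambda>m. ereal (orbit j m)) \<longlonglongrightarrow> L)"
proof -
  have "(\<forall>U. open U \<and> L \<in> U \<longrightarrow>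
      (\<exists>\<delta>>0. AE x in leb01. x \<in> {xh - \<delta><..<xh} \<longrightarrow> ereal (f x) \<in> U))
    \<longleftrightarrow> (\<forall>j\<in>{1..<k}. (\<lambda>m. ereal (orbit j m)) \<longlonglongrightarrow> L)"
  proof (rule ess_limit_iff_orbits)
    show "{1..<k} \<subseteq> {1..n} - {k}" using k_in by auto
    fix M
    obtain \<delta> where "\<delta> > 0"
      and \<delta>: "\<And>x m j. j \<in> {1..n} - {k} \<Longrightarrow> \<bar>x - xh\<bar> < \<delta> \<Longrightarrow> x \<in> piece m j \<Longrightarrow> M \<le> m"
      using near_pieces_are_deep[of M] by blast
    show "\<exists>\<delta>>0. \<forall>x m j. j \<in> {1..n} - {k} \<longrightarrow> x \<in> {xh - \<delta><..<xh} \<longrightarrow> x \<in> piece m j \<longrightarrow> j \<in> {1..<k} \<and> M \<le> m"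
    proof (intro exI[of _ \<delta>] conjI allI impI)
      fix x m j assume j: "j \<in> {1..n} - {k}" and x: "x \<in> {xh - \<delta><..<xh}" "x \<in> piece m j"
      then show "M \<le> m" using \<delta>[OF j _ x(2)] by auto
      show "j \<in> {1..<k}" using piece_above[of j x m] j x by force
    qed (rule \<open>\<delta> > 0\<close>)
  next
    fix \<delta> j m assume "j \<in> {1..<k}" "a k ^ m < \<delta>"
    then show "piece m j \<subseteq> {xh - \<delta><..<xh}"
      using piece_abs_less[of j _ m] piece_below[of j _ m] k_in by fastforce
  qed
  moreover have "xh \<in> {0<..1} \<longleftrightarrow> 1 < k"
    using xh_pos xh_le_1 k_in by (auto simp: xh_def alpha_def le_less)
  ultimately show ?thesis by (simp add: ess_left_lim_def)
qed

lemma ess_right_lim_iff: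
  "ess_right_lim f xh L \<longleftrightarrow> k < n \<and> (\<forall>j\<in>{k<..n}. (\<lambda>m. ereal (orbit j m)) \<longlonglongrightarrow> L)"
proof -
  have "(\<forall>U. open U \<and> L \<in> U \<longrightarrow>
      (\<exists>\<delta>>0. AE x in leb01. x \<in> {xh<..<xh + \<delta>} \<longrightarrow> ereal (f x) \<in> U))
    \<longleftrightarrow> (\<forall>j\<in>{k<..n}. (\<lambda>m. ereal (orbit j m)) \<longlonglongrightarrow> L)"
  proof (rule ess_limit_iff_orbits)
    show "{k<..n} \<subseteq> {1..n} - {k}" using k_in by auto
    fix M
    obtain \<delta> where "\<delta> > 0"
      and \<delta>: "\<And>x m j. j \<in> {1..n} - {k} \<Longrightarrow> \<bar>x - xh\<bar> < \<delta> \<Longrightarrow> x \<in> piece m j \<Longrightarrow> M \<le> m"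
      using near_pieces_are_deep[of M] by blast
    show "\<exists>\<delta>>0. \<forall>x m j. j \<in> {1..n} - {k} \<longrightarrow> x \<in> {xh<..<xh + \<delta>} \<longrightarrow> x \<in> piece m j \<longrightarrow> j \<in> {k<..n} \<and> M \<le> m"
    proof (intro exI[of _ \<delta>] conjI allI impI)
      fix x m j assume j: "j \<in> {1..n} - {k}" and x: "x \<in> {xh<..<xh + \<delta>}" "x \<in> piece m j"
      then show "M \<le> m" using \<delta>[OF j _ x(2)] by auto
      show "j \<in> {k<..n}" using piece_below[of j x m] j x by force
    qed (rule \<open>\<delta> > 0\<close>)
  next
    fix \<delta> j m assume "j \<in> {k<..n}" "a k ^ m < \<delta>"
    then show "piece m j \<subseteq> {xh<..<xh + \<delta>}"
      using piece_abs_less[of j _ m] piece_above[of j _ m] k_in by fastforce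
  qed
  moreover have "xh \<in> {0..<1} \<longleftrightarrow> k < n"
  proof -
    have "xh = 1" if "k = n"
    proof -
      have "(1 - a k) * (1 - xh) = 0"
        using alpha_Suc_k that by (simp add: alpha_end algebra_simps)
      then show ?thesis using ak_less_1 by simp
    qed
    then show ?thesis using xh_less_1 xh_nonneg k_in by (auto simp: le_less)
  qed
  ultimately show ?thesis by (simp add: ess_right_lim_def)
qed

lemma ess_lim_iff:
  "ess_lim f xh L \<longleftrightarrow> (\<forall>j\<in>{1..n} - {k}. (\<lambda>m. ereal (orbit j m)) \<longlonglongrightarrow> L)"
proof -
  have "(\<forall>U. open U \<and> L \<in> U \<longrightarrow>
      (\<exists>\<delta>>0. AE x in leb01. x \<in> {x. x \<noteq> xh \<and> \<bar>x - xh\<bar> < \<delta>} \<longrightarrow> ereal (f x) \<in> U))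
    \<longleftrightarrow> (\<forall>j\<in>{1..n} - {k}. (\<lambda>m. ereal (orbit j m)) \<longlonglongrightarrow> L)"
  proof (rule ess_limit_iff_orbits)
    fix M
    show "\<exists>\<delta>>0. \<forall>x m j. j \<in> {1..n} - {k} \<longrightarrow> x \<in> {x. x \<noteq> xh \<and> \<bar>x - xh\<bar> < \<delta>} \<longrightarrow>
        x \<in> piece m j \<longrightarrow> j \<in> {1..n} - {k} \<and> M \<le> m"
      using near_pieces_are_deep[of M] by blast
  next
    fix \<delta> j m assume *: "j \<in> {1..n} - {k}" "a k ^ m < \<delta>"
    show "piece m j \<subseteq> {x. x \<noteq> xh \<and> \<bar>x - xh\<bar> < \<delta>}"
    proof
      fix x assume "x \<in> piece m j"
      then show "x \<in> {x. x \<noteq> xh \<and> \<bar>x - xh\<bar> < \<delta>}"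
        using piece_abs_less[of j x m] piece_below[of j x m] piece_above[of j x m] *
        by (cases j k rule: linorder_cases) auto
    qed
  qed simp
  then show ?thesis
    using xh_nonneg xh_le_1 by (simp add: ess_lim_def)
qed

text \<open>
  Taking \<open>i = j\<close> covers a single orbit without finite limit: the one-sided limit is then
  infinite or missing, and both count as a discontinuity of the second kind.
\<close>
lemma second_kindI:
  assumes side: "{i, j} \<subseteq> {1..<k} \<or> {i, j} \<subseteq> {k<..n}"
    and no_lim: "\<And>L. orbit i \<longlonglongrightarrow> L \<Longrightarrow> orbit j \<longlonglongrightarrow> L \<Longrightarrow> False"
  shows "discontinuity_second_kind f xh"
  using side
proof
  assume ij: "{i, j} \<subseteq> {1..<k}"
  then have "L = \<infinity> \<or> L = -\<infinity>" if "ess_left_lim f xh L" for L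
    using that no_lim ij by (cases L) (fastforce simp: ess_left_lim_iff)+
  moreover have "xh \<in> {0<..1}" using ij xh_pos xh_le_1 by auto
  ultimately show ?thesis unfolding discontinuity_second_kind_def by blast
next
  assume ij: "{i, j} \<subseteq> {k<..n}"
  then have "L = \<infinity> \<or> L = -\<infinity>" if "ess_right_lim f xh L" for L
    using that no_lim ij by (cases L) (fastforce simp: ess_right_lim_iff)+
  moreover have "xh \<in> {0..<1}" using ij xh_less_1 xh_nonneg by auto
  ultimately show ?thesis unfolding discontinuity_second_kind_def by blast
qed

lemma ess_constantI:
  assumes "\<And>j m. j \<in> {1..n} - {k} \<Longrightarrow> orbit j m = c"
  shows "ess_constant f"
proof -
  have "AE x in leb01. f x = c"
    unfolding AE_leb01_iff using f_values by eventually_elim (use assms in auto)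
  then show ?thesis by (auto simp: ess_constant_def)
qed


section \<open>Orbits of the affine value map\<close>

lemma orbit_shift: "d = 1 \<Longrightarrow> orbit j m = \<beta> j + real m * \<beta> k"
  unfolding orbit_def by (induction m) (auto simp: algebra_simps)

lemma orbit_geometric:
  assumes "d \<noteq> 1"
  shows "orbit j m = \<beta> k / (1 - d) + d ^ m * (\<beta> k / (d - 1) + \<beta> j)"
proof (induction m)
  case 0
  have "\<beta> k / (1 - d) = - (\<beta> k / (d - 1))"
    by (metis minus_diff_eq minus_divide_right)
  then show ?case by (simp add: orbit_def)
next
  case (Suc m)
  have "orbit j (Suc m) = \<beta> k + d * orbit j m" by (simp add: orbit_def)
  moreover have "\<beta> k + d * (\<beta> k / (1 - d)) = \<beta> k / (1 - d)"
    using assms by (simp add: field_simps)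
  ultimately show ?case using Suc by (simp add: algebra_simps)
qed

text \<open>
  Consecutive terms differ by \<open>d ^ m * ((d - 1) * c)\<close> with \<open>c\<close> the deviation from the fixed point.
  This stays away from \<open>0\<close> for either sign of \<open>d\<close>, so growth and oscillation need no separate
  treatment.
\<close>
lemma orbit_diverges:
  assumes "1 \<le> \<bar>d\<bar>" "d \<noteq> 1" "\<beta> k / (d - 1) + \<beta> j \<noteq> 0"
  shows "\<not> orbit j \<longlonglongrightarrow> L"
proof
  let ?c = "\<beta> k / (d - 1) + \<beta> j"
  assume L: "orbit j \<longlonglongrightarrow> L"
  have "(\<lambda>m. orbit j (Suc m) - orbit j m) \<longlonglongrightarrow> L - L"
    by (intro tendsto_diff LIMSEQ_Suc L)
  moreover have "orbit j (Suc m) - orbit j m = d ^ m * ((d - 1) * ?c)" for m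
    by (simp add: orbit_geometric[OF assms(2)] left_diff_distrib right_diff_distrib)
  ultimately have "(\<lambda>m. \<bar>d ^ m * ((d - 1) * ?c)\<bar>) \<longlonglongrightarrow> 0"
    using tendsto_rabs_zero by fastforce
  moreover have "\<bar>(d - 1) * ?c\<bar> \<le> \<bar>d ^ m * ((d - 1) * ?c)\<bar>" for m
    using one_le_power[OF assms(1), of m]
    by (subst (2) abs_mult) (simp add: power_abs mult_le_cancel_right1)
  ultimately have "\<bar>(d - 1) * ?c\<bar> \<le> 0"
    by (intro LIMSEQ_le_const) auto
  then show False using assms by simp
qed

lemma second_kind_expanding:
  assumes "1 \<le> \<bar>d\<bar>" "d \<noteq> 1" "\<not> ess_constant f"
  shows "discontinuity_second_kind f xh"
proof -
  obtain j where "j \<in> {1..n} - {k}" "\<beta> k / (d - 1) + \<beta> j \<noteq> 0"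
    using assms(3) ess_constantI[of "\<beta> k / (1 - d)"] by (auto simp: orbit_geometric[OF assms(2)])
  then show ?thesis
    using orbit_diverges[OF assms(1,2)] by (intro second_kindI[of j j]) auto
qed

lemma contracting_case:
  assumes "\<bar>d\<bar> < 1"
  shows "ess_bounded f" "ess_lim f xh (ereal (\<beta> k / (1 - d)))"
proof -
  have d1: "d \<noteq> 1" using assms by auto
  let ?c = "\<lambda>j. \<beta> k / (d - 1) + \<beta> j"
  have "\<bar>orbit j m\<bar> \<le> \<bar>\<beta> k / (1 - d)\<bar> + (\<Sum>i = 1..n. \<bar>?c i\<bar>)" if "j \<in> {1..n}" for j m
  proof -
    have "\<bar>d ^ m * ?c j\<bar> \<le> 1 * \<bar>?c j\<bar>"
      unfolding abs_mult using assms by (intro mult_right_mono) (auto simp: power_abs power_le_one)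
    also have "1 * \<bar>?c j\<bar> \<le> (\<Sum>i = 1..n. \<bar>?c i\<bar>)"
      using member_le_sum[OF that, of "\<lambda>i. \<bar>?c i\<bar>"] by simp
    finally show ?thesis unfolding orbit_geometric[OF d1] by linarith
  qed
  then have "AE x in leb01. \<bar>f x\<bar> \<le> \<bar>\<beta> k / (1 - d)\<bar> + (\<Sum>i = 1..n. \<bar>?c i\<bar>)"
    unfolding AE_leb01_iff using f_values by (auto elim!: eventually_mono)
  then show "ess_bounded f" unfolding ess_bounded_def by blast
  have "orbit j \<longlonglongrightarrow> \<beta> k / (1 - d) + 0 * ?c j" for j
    unfolding orbit_geometric[OF d1, abs_def]
    using assms by (intro tendsto_intros LIMSEQ_power_zero) auto
  then show "ess_lim f xh (ereal (\<beta> k / (1 - d)))"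
    by (simp add: ess_lim_iff)
qed

lemma shift_case:
  assumes "d = 1" "\<beta> k \<noteq> 0"
  shows "ess_lim f xh (ereal (sgn (\<beta> k)) * \<infinity>)"
  using affine_tendsto_sgn_infinity[OF filterlim_real_sequentially assms(2)]
  by (simp add: ess_lim_iff orbit_shift[OF assms(1)])

text \<open>
  If the common sign were zero, all orbits would sit at the fixed point and \<open>f\<close> would be constant.
\<close>
lemma expanding_same_sign:
  assumes "1 < d" "\<not> ess_constant f"
    and same: "\<forall>i\<in>{1..n} - {k}. \<forall>j\<in>{1..n} - {k}.
      sgn (\<beta> k / (d - 1) + \<beta> i) = sgn (\<beta> k / (d - 1) + \<beta> j)"
    and "j \<in> {1..n} - {k}"
  shows "ess_lim f xh (ereal (sgn (\<beta> k / (d - 1) + \<beta> j)) * \<infinity>)"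
  unfolding ess_lim_iff
proof
  have d1: "d \<noteq> 1" using assms(1) by simp
  fix i assume i: "i \<in> {1..n} - {k}"
  have "\<beta> k / (d - 1) + \<beta> i \<noteq> 0"
  proof
    assume "\<beta> k / (d - 1) + \<beta> i = 0"
    then have "\<beta> k / (d - 1) + \<beta> l = 0" if "l \<in> {1..n} - {k}" for l
      using same i that by (metis sgn_eq_0_iff)
    then have "ess_constant f"
      by (intro ess_constantI[of "\<beta> k / (1 - d)"]) (simp add: orbit_geometric[OF d1])
    with assms(2) show False by blast
  qed
  then have "(\<lambda>m. ereal (orbit i m)) \<longlonglongrightarrow> ereal (sgn (\<beta> k / (d - 1) + \<beta> i)) * \<infinity>"
    unfolding orbit_geometric[OF d1]
    using filterlim_realpow_sequentially_gt1[of d] assms(1)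
    by (intro affine_tendsto_sgn_infinity) (auto simp: filterlim_at_infinity_imp_filterlim_at_top)
  moreover have "sgn (\<beta> k / (d - 1) + \<beta> i) = sgn (\<beta> k / (d - 1) + \<beta> j)"
    using same i assms(4) by blast
  ultimately show "(\<lambda>m. ereal (orbit i m)) \<longlonglongrightarrow> ereal (sgn (\<beta> k / (d - 1) + \<beta> j)) * \<infinity>"
    by simp
qed

lemma orbit_fixed: "d * \<beta> j + \<beta> k = \<beta> j \<Longrightarrow> orbit j m = \<beta> j"
  unfolding orbit_def by (induction m) auto

lemma identity_first_kind:
  assumes "d = 1" "\<beta> k = 0" "n = 3" "k = 2" "\<not> ess_constant f"
  shows "ess_finitely_many_values f" "discontinuity_first_kind f xh"
    "ess_left_lim f xh (ereal (\<beta> 1))" "ess_right_lim f xh (ereal (\<beta> 3))"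
proof -
  have orbit: "orbit j m = \<beta> j" for j m
    using orbit_shift[OF assms(1)] assms(2) by simp
  have "AE x in leb01. f x \<in> \<beta> ` {1..n}"
    unfolding AE_leb01_iff using f_values by eventually_elim (auto simp: orbit)
  then show "ess_finitely_many_values f"
    unfolding ess_finitely_many_values_def by blast
  show l: "ess_left_lim f xh (ereal (\<beta> 1))" and r: "ess_right_lim f xh (ereal (\<beta> 3))"
  proof -
    have "{1..<k} = {1}" "{k<..n} = {3}" using assms(3,4) by auto
    then show "ess_left_lim f xh (ereal (\<beta> 1))" "ess_right_lim f xh (ereal (\<beta> 3))"
      unfolding ess_left_lim_iff ess_right_lim_iff orbit using assms(3,4) by auto
  qed
  have "\<beta> 1 \<noteq> \<beta> 3"
  proof
    assume "\<beta> 1 = \<beta> 3"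
    moreover have "j = 1 \<or> j = 3" if "j \<in> {1..n} - {k}" for j
      using that assms by auto
    ultimately have "ess_constant f"
      by (intro ess_constantI[of "\<beta> 1"]) (auto simp: orbit)
    with assms show False by blast
  qed
  with l r show "discontinuity_first_kind f xh"
    unfolding discontinuity_first_kind_def by blast
qed

text \<open>
  For \<open>n \<ge> 3\<close> and \<open>(n, k) \<noteq> (3, 2)\<close> some side of \<open>k\<close> has two neighbouring indices, whose
  constants differ and recur at every scale; \<open>n = 2\<close> leaves one constant only.
\<close>
lemma identity_second_kind:
  assumes "d = 1" "\<beta> k = 0" "\<not> (n = 3 \<and> k = 2)" "\<not> ess_constant f"
    and distinct: "\<forall>i\<in>{1..n - 1}. i \<noteq> k \<and> i + 1 \<noteq> k \<longrightarrow> \<beta> i \<noteq> \<beta> (i + 1)"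
  shows "discontinuity_second_kind f xh"
proof -
  have orbit: "orbit j = (\<lambda>_. \<beta> j)" for j
    using orbit_shift[OF assms(1)] assms(2) by (simp add: fun_eq_iff)
  have "n \<noteq> 2"
  proof
    assume "n = 2"
    then have "j = 3 - k" if "j \<in> {1..n} - {k}" for j
      using that k_in by auto
    then have "ess_constant f"
      by (intro ess_constantI[of "\<beta> (3 - k)"]) (auto simp: orbit)
    with assms show False by blast
  qed
  then have "{1, Suc 1} \<subseteq> {1..<k} \<or> {n - 1, Suc (n - 1)} \<subseteq> {k<..n}"
    using assms(3) k_in n_gt_1 by auto
  then obtain i where i: "i \<in> {1..n - 1}" "i \<noteq> k" "i + 1 \<noteq> k"
    and side: "{i, Suc i} \<subseteq> {1..<k} \<or> {i, Suc i} \<subseteq> {k<..n}"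
    using k_in n_gt_1 by (elim disjE) (force intro: that[of 1], force intro: that[of "n - 1"])
  have "\<beta> i \<noteq> \<beta> (Suc i)" using distinct i by auto
  with side show ?thesis
    by (intro second_kindI[of i "Suc i"]) (auto simp: orbit LIMSEQ_const_iff)
qed

end


section \<open>The classification for similarity operators\<close>

text \<open>
  \<open>G_hat\<close> lives on closed intervals, so neighbouring summands overlap at the points \<open>alpha a j\<close>;
  on the open intervals a single summand survives.
\<close>
lemma similarity_op_on_interval:
  assumes pos: "\<And>j. j \<in> {1..n} \<Longrightarrow> 0 < a j" and j: "j \<in> {1..n}"
    and x: "x \<in> {alpha a j<..<alpha a (Suc j)}"
  shows "similarity_op n a d \<beta> ori f x = \<beta> j + d j * G_hat a (ori j) j f x"
proof -
  have mono: "alpha a i \<le> alpha a l" if "1 \<le> i" "i \<le> l" "l \<le> Suc n" for i l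
    using alpha_mono[of n a i l] pos that by blast
  have out: "x \<notin> {alpha a i..alpha a (Suc i)}" if "i \<in> {1..n}" "i \<noteq> j" for i
    using mono[of "Suc i" j] mono[of "Suc j" i] that j x
    by (cases i j rule: linorder_cases) auto
  have G: "G_hat a (ori i) i f x = 0" if "i \<in> {1..n} - {j}" for i
    using out[of i] that by (cases "ori i") auto
  have "(\<Sum>i = 1..n. \<beta> i * indicator {alpha a i<..<alpha a (i + 1)} x + d i * G_hat a (ori i) i f x)
    = \<beta> j * indicator {alpha a j<..<alpha a (j + 1)} x + d j * G_hat a (ori j) j f x"
    using j G out[unfolded atLeastAtMost_iff not_le]
    by (subst sum.remove[of _ j]) (fastforce intro!: sum.neutral simp: indicator_def)+
  then show ?thesis using x by (simp add: similarity_op_def)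
qed

theorem mainTheorem3:
  fixes p :: ennreal and n kh :: nat and a d \<beta> :: "nat \<Rightarrow> real"
    and ori :: "nat \<Rightarrow> orientation" and f :: "real \<Rightarrow> real" and xh :: real
  assumes "1 \<le> p"
    and "self_similar p n a d \<beta> ori f"
    and "zero_spectral_order n d"
    and "kh \<in> {1..n}" and "d kh \<noteq> 0"
    and "ori kh = Preserving"
    and "xh = alpha a kh / (1 - a kh)"
    and "\<forall>i\<in>{1..n - 1}. i \<noteq> kh \<and> i + 1 \<noteq> kh \<longrightarrow> \<beta> i \<noteq> \<beta> (i + 1)"
    and "\<not> ess_constant f"
  shows
    "(\<bar>d kh\<bar> < 1 \<longrightarrow> ess_bounded f \<and> ess_lim f xh (ereal (\<beta> kh / (1 - d kh))))
   \<and> (d kh = 1 \<longrightarrow>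
        (\<beta> kh = 0 \<and> n = 3 \<and> kh = 2 \<longrightarrow>
           ess_finitely_many_values f \<and> discontinuity_first_kind f xh
           \<and> ess_left_lim f xh (ereal (\<beta> 1)) \<and> ess_right_lim f xh (ereal (\<beta> 3)))
      \<and> (\<beta> kh = 0 \<and> \<not> (n = 3 \<and> kh = 2) \<longrightarrow> discontinuity_second_kind f xh)
      \<and> (\<beta> kh \<noteq> 0 \<longrightarrow> ess_lim f xh (ereal (sgn (\<beta> kh)) * \<infinity>)))
   \<and> (d kh > 1 \<longrightarrow>
        ((\<forall>i\<in>{1..n} - {kh}. \<forall>j\<in>{1..n} - {kh}.
            sgn (\<beta> kh / (d kh - 1) + \<beta> i) = sgn (\<beta> kh / (d kh - 1) + \<beta> j)) \<longrightarrow>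
           (\<forall>j\<in>{1..n} - {kh}.
              ess_lim f xh (ereal (sgn (\<beta> kh / (d kh - 1) + \<beta> j)) * \<infinity>)))
      \<and> (\<not> (\<forall>i\<in>{1..n} - {kh}. \<forall>j\<in>{1..n} - {kh}.
            sgn (\<beta> kh / (d kh - 1) + \<beta> i) = sgn (\<beta> kh / (d kh - 1) + \<beta> j)) \<longrightarrow>
           discontinuity_second_kind f xh)
      \<and> (kh = 2 \<and> d 2 * \<beta> 1 + \<beta> 2 = \<beta> 1 \<longrightarrow> ess_left_lim f xh (ereal (\<beta> 1)))
      \<and> (kh = n - 1 \<and> d (n - 1) * \<beta> n + \<beta> (n - 1) = \<beta> n \<longrightarrow> ess_right_lim f xh (ereal (\<beta> n))))
   \<and> (d kh \<le> -1 \<longrightarrow> discontinuity_second_kind f xh)"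
proof -
  have params: "1 < n" "\<And>j. j \<in> {1..n} \<Longrightarrow> 0 < a j" "(\<Sum>j = 1..n. a j) = 1"
    and fix_eq: "AE x in leb01. similarity_op n a d \<beta> ori f x = f x"
    using assms(2) by (auto simp: self_similar_def similarity_params_def)
  have d0: "d j = 0" if "j \<in> {1..n} - {kh}" for j
    using assms(3-5) that unfolding zero_spectral_order_def by blast
  interpret one_branch_fixed_point n kh a \<beta> "d kh" xh f
  proof
    fix j assume j: "j \<in> {1..n} - {kh}"
    show "AE x in leb01. x \<in> {alpha a j<..<alpha a (Suc j)} \<longrightarrow> f x = \<beta> j"
      using fix_eq
    proof eventually_elim
      case (elim x)
      then show ?case
        using similarity_op_on_interval[of n a j x d \<beta> ori f] params(2) d0[OF j] j by auto
    qed
  next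
    show "AE x in leb01. x \<in> {alpha a kh<..<alpha a (Suc kh)} \<longrightarrow>
        f x = \<beta> kh + d kh * f ((x - alpha a kh) / a kh)"
      using fix_eq
    proof eventually_elim
      case (elim x)
      then show ?case
        using similarity_op_on_interval[of n a kh x d \<beta> ori f] params(2) assms(4,6) by auto
    qed
  qed (use params assms in auto)
  have left: "ess_left_lim f xh (ereal (\<beta> 1))" if "kh = 2" "d 2 * \<beta> 1 + \<beta> 2 = \<beta> 1"
  proof -
    have "orbit j m = \<beta> 1" if "j \<in> {1..<kh}" for j m
      using orbit_fixed[of 1 m] that \<open>kh = 2\<close> \<open>d 2 * \<beta> 1 + \<beta> 2 = \<beta> 1\<close> by (cases "j = 1") auto
    then show ?thesis using that by (simp add: ess_left_lim_iff)
  qed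
  have right: "ess_right_lim f xh (ereal (\<beta> n))"
    if "kh = n - 1" "d (n - 1) * \<beta> n + \<beta> (n - 1) = \<beta> n"
  proof -
    have "orbit j m = \<beta> n" if "j \<in> {kh<..n}" for j m
      using orbit_fixed[of n m] that \<open>kh = n - 1\<close> \<open>d (n - 1) * \<beta> n + \<beta> (n - 1) = \<beta> n\<close>
      by (cases "j = n") auto
    then show ?thesis using that n_gt_1 by (simp add: ess_right_lim_iff)
  qed
  show ?thesis
  proof (intro conjI impI ballI; (elim conjE)?)
    show "ess_bounded f" "ess_lim f xh (ereal (\<beta> kh / (1 - d kh)))" if "\<bar>d kh\<bar> < 1"
      using contracting_case[OF that] by blast+
  next
    assume "d kh = 1" "\<beta> kh = 0" "n = 3" "kh = 2"
    note identity_first_kind[OF this assms(9)]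
    then show "ess_finitely_many_values f" "discontinuity_first_kind f xh"
      "ess_left_lim f xh (ereal (\<beta> 1))" "ess_right_lim f xh (ereal (\<beta> 3))"
      by blast+
  next
    assume "d kh = 1" "\<beta> kh = 0" "\<not> (n = 3 \<and> kh = 2)"
    then show "discontinuity_second_kind f xh"
      by (rule identity_second_kind[OF _ _ _ assms(9,8)])
  next
    assume "d kh = 1" "\<beta> kh \<noteq> 0"
    then show "ess_lim f xh (ereal (sgn (\<beta> kh)) * \<infinity>)"
      by (rule shift_case)
  next
    fix j
    assume "1 < d kh" "\<forall>i\<in>{1..n} - {kh}. \<forall>j\<in>{1..n} - {kh}.
        sgn (\<beta> kh / (d kh - 1) + \<beta> i) = sgn (\<beta> kh / (d kh - 1) + \<beta> j)" "j \<in> {1..n} - {kh}"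
    then show "ess_lim f xh (ereal (sgn (\<beta> kh / (d kh - 1) + \<beta> j)) * \<infinity>)"
      using assms(9) by (intro expanding_same_sign) 
  next
    assume "1 < d kh"
    then show "discontinuity_second_kind f xh"
      using assms(9) by (intro second_kind_expanding) auto
  next
    assume "kh = 2" "d 2 * \<beta> 1 + \<beta> 2 = \<beta> 1"
    then show "ess_left_lim f xh (ereal (\<beta> 1))" by (rule left)
  next
    assume "kh = n - 1" "d (n - 1) * \<beta> n + \<beta> (n - 1) = \<beta> n"
    then show "ess_right_lim f xh (ereal (\<beta> n))" by (rule right)
  next
    assume "d kh \<le> - 1"
    then show "discontinuity_second_kind f xh"
      using assms(9) by (intro second_kind_expanding) auto
  qed
qed

end
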